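(* Let $X$ be a pre-$L$-algebra, $\mathcal{C}(X)$ its lattice of congruences, and $\mathcal{I}(X)$ its lattice of ideals (both ordered by inclusion). Define two mappings $$\varphi\colon\mathcal{C}(X)\to\mathcal{I}(X),\qquad \varphi(\sim)=[1]_{\sim},$$ sending a congruence $\sim$ of $X$ to the equivalence class modulo $\sim$ of the logical unit $1$, and $$\psi\colon\mathcal{I}(X)\to\mathcal{C}(X),\qquad \psi(I)={\sim_I},$$ where $\sim_I$ is the relation on $X$ defined, for every $x,y\in X$, by $x\sim_I y$ if both $x\cdot y\in I$ and $y\cdot x\in I$. Then: (a) $\varphi$ and $\psi$ are well-defined, i.e. $[1]_\sim$ is an ideal of $X$ for every congruence $\sim$ of $X$, and $\sim_I$ is a congruence of $X$ for every ideal $I$ of $X$; (b) $\varphi\psi=\mathrm{id}_{\mathcal{I}(X)}$; (c) $\varphi$ and $\psi$ form a monotone Galois connection between $\mathcal{C}(X)$ and $\mathcal{I}(X)$ (that is, both are order-preserving, and for every $\sim\,\in\mathcal{C}(X)$ and $I\in\mathcal{I}(X)$ one has $\varphi(\sim)\subseteq I$ if and only if $\sim\,\subseteq\psi(I)$); (d) $\psi\varphi$ is a closure operator on $\mathcal{C}(X)$; (e) the image of $\psi$ is the set of all congruences $\sim$ of $X$ for which $X/{\sim}$ is an $L$-algebra; (f) for every $\sim\,\in\mathcal{C}(X)$, $\psi\varphi(\sim)$ is the smallest congruence $\equiv$ on $X$ that contains $\sim$ and is such that $X/{\equiv}$ is an $L$-algebra.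
   Context: A pre-$L$-algebra is a set $X$ with a binary operation $(x,y)\mapsto x\cdot y$ and a constant $1\in X$ (the logical unit) such that for all $x,y,z\in X$: (1) $x\cdot x=x\cdot 1=1$ and $1\cdot x=x$; (2) $(x\cdot y)\cdot(x\cdot z)=(y\cdot x)\cdot(y\cdot z)$. An $L$-algebra is a pre-$L$-algebra that also satisfies (3): $x\cdot y=y\cdot x=1$ implies $x=y$. A congruence on $X$ is an equivalence relation on $X$ compatible with the operation $\cdot$, and $X/{\sim}$ is the quotient pre-$L$-algebra. An ideal of a pre-$L$-algebra $X$ is a subset $I\subseteq X$ such that for all $x,y\in X$: $1\in I$; if $x\in I$ and $x\cdot y\in I$ then $y\in I$; if $x\in I$ then $(x\cdot y)\cdot y\in I$; if $x\in I$ then $y\cdot x\in I$; if $x\in I$ then $y\cdot(x\cdot y)\in I$. For partially ordered sets $A,B$, a monotone Galois connection between $A$ and $B$ consists of order-preserving maps $f\colon A\to B$ and $g\colon B\to A$ such that $f(a)\le b$ if and only if $a\le g(b)$ for all $a\in A$, $b\in B$. A closure operator on a partially ordered set $A$ is a map $c\colon A\to A$ such that $x\le c(y)$ if and only if $c(x)\le c(y)$ for all $x,y\in A$. *)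

theory Defs
  imports "HOL-Algebra.Galois_Connection"
begin

record 'a lstruct = "'a partial_object" +
  lop :: "'a \<Rightarrow> 'a \<Rightarrow> 'a" (infixl \<open>\<cdot>\<index>\<close> 70)
  lunit :: 'a (\<open>\<one>\<index>\<close>)

locale pre_L_algebra =
  fixes X (structure)
  assumes lop_closed: "\<lbrakk>x \<in> carrier X; y \<in> carrier X\<rbrakk> \<Longrightarrow> x \<cdot> y \<in> carrier X"
    and lunit_closed: "\<one> \<in> carrier X"
    and lop_self: "x \<in> carrier X \<Longrightarrow> x \<cdot> x = \<one>"
    and lop_lunit: "x \<in> carrier X \<Longrightarrow> x \<cdot> \<one> = \<one>"
    and lunit_lop: "x \<in> carrier X \<Longrightarrow> \<one> \<cdot> x = x"
    and cycloid: "\<lbrakk>x \<in> carrier X; y \<in> carrier X; z \<in> carrier X\<rbrakk>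
      \<Longrightarrow> (x \<cdot> y) \<cdot> (x \<cdot> z) = (y \<cdot> x) \<cdot> (y \<cdot> z)"

locale L_algebra = pre_L_algebra +
  assumes lop_antisym: "\<lbrakk>x \<in> carrier X; y \<in> carrier X; x \<cdot> y = \<one>; y \<cdot> x = \<one>\<rbrakk> \<Longrightarrow> x = y"

definition L_congruence :: "('a, 'b) lstruct_scheme \<Rightarrow> 'a rel \<Rightarrow> bool" where
  "L_congruence X r \<longleftrightarrow> equiv (carrier X) r \<and>
     (\<forall>x x' y y'. (x, x') \<in> r \<longrightarrow> (y, y') \<in> r \<longrightarrow> (x \<cdot>\<^bsub>X\<^esub> y, x' \<cdot>\<^bsub>X\<^esub> y') \<in> r)"

definition L_ideal :: "('a, 'b) lstruct_scheme \<Rightarrow> 'a set \<Rightarrow> bool" where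
  "L_ideal X I \<longleftrightarrow> I \<subseteq> carrier X \<and> \<one>\<^bsub>X\<^esub> \<in> I \<and>
     (\<forall>x\<in>carrier X. \<forall>y\<in>carrier X.
        (x \<in> I \<longrightarrow> x \<cdot>\<^bsub>X\<^esub> y \<in> I \<longrightarrow> y \<in> I) \<and>
        (x \<in> I \<longrightarrow> (x \<cdot>\<^bsub>X\<^esub> y) \<cdot>\<^bsub>X\<^esub> y \<in> I) \<and>
        (x \<in> I \<longrightarrow> y \<cdot>\<^bsub>X\<^esub> x \<in> I) \<and>
        (x \<in> I \<longrightarrow> y \<cdot>\<^bsub>X\<^esub> (x \<cdot>\<^bsub>X\<^esub> y) \<in> I))"

abbreviation inclusion_order :: "'a set set \<Rightarrow> 'a set gorder" where
  "inclusion_order S \<equiv> \<lparr>carrier = S, eq = (=), le = (\<subseteq>)\<rparr>"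

definition congruences :: "('a, 'b) lstruct_scheme \<Rightarrow> 'a rel gorder" where
  "congruences X = inclusion_order {r. L_congruence X r}"

definition ideals :: "('a, 'b) lstruct_scheme \<Rightarrow> 'a set gorder" where
  "ideals X = inclusion_order {I. L_ideal X I}"

text \<open>The product of two classes is written as a union over all representatives; for a
  congruence it is the class of the product of any two representatives, see
  \<open>quot_lop\<close> below.\<close>

definition quot :: "('a, 'b) lstruct_scheme \<Rightarrow> 'a rel \<Rightarrow> 'a set lstruct" where
  "quot X r = \<lparr>carrier = carrier X // r,
     lop = (\<lambda>A B. \<Union>x\<in>A. \<Union>y\<in>B. r `` {x \<cdot>\<^bsub>X\<^esub> y}),
     lunit = r `` {\<one>\<^bsub>X\<^esub>}\<rparr>"

lemma quot_lop:
  assumes "L_congruence X r" "x \<in> carrier X" "y \<in> carrier X"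
  shows "r `` {x} \<cdot>\<^bsub>quot X r\<^esub> r `` {y} = r `` {x \<cdot>\<^bsub>X\<^esub> y}"
proof -
  have eq: "equiv (carrier X) r"
    and compat: "\<And>x x' y y'. \<lbrakk>(x, x') \<in> r; (y, y') \<in> r\<rbrakk> \<Longrightarrow> (x \<cdot>\<^bsub>X\<^esub> y, x' \<cdot>\<^bsub>X\<^esub> y') \<in> r"
    using assms(1) unfolding L_congruence_def by blast+
  have "congruent2 r r (\<lambda>x y. r `` {x \<cdot>\<^bsub>X\<^esub> y})"
    by (rule congruent2I') (rule equiv_class_eq[OF eq compat])
  then show ?thesis
    using UN_equiv_class2[OF eq eq _ assms(2,3)] by (simp add: quot_def)
qed

lemma (in pre_L_algebra) pre_L_algebra_quot:
  assumes "L_congruence X r"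
  shows "pre_L_algebra (quot X r)"
proof -
  have eq: "carrier (quot X r) = (\<lambda>x. r `` {x}) ` carrier X"
    "\<one>\<^bsub>quot X r\<^esub> = r `` {\<one>}"
    by (auto simp: quot_def quotient_def)
  note [simp] = quot_lop[OF assms] eq lop_closed lunit_closed lop_self lop_lunit lunit_lop
  show ?thesis
    by unfold_locales (auto simp: cycloid)
qed

definition closure_operator :: "('a, 'b) gorder_scheme \<Rightarrow> ('a \<Rightarrow> 'a) \<Rightarrow> bool" where
  "closure_operator A c \<longleftrightarrow> partial_order A \<and> c \<in> carrier A \<rightarrow> carrier A \<and>
     (\<forall>x\<in>carrier A. \<forall>y\<in>carrier A. x \<sqsubseteq>\<^bsub>A\<^esub> c y \<longleftrightarrow> c x \<sqsubseteq>\<^bsub>A\<^esub> c y)"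

definition unit_class :: "('a, 'b) lstruct_scheme \<Rightarrow> 'a rel \<Rightarrow> 'a set" where
  "unit_class X r = r `` {\<one>\<^bsub>X\<^esub>}"

definition ideal_rel :: "('a, 'b) lstruct_scheme \<Rightarrow> 'a set \<Rightarrow> 'a rel" where
  "ideal_rel X I = {(x, y). x \<in> carrier X \<and> y \<in> carrier X \<and> x \<cdot>\<^bsub>X\<^esub> y \<in> I \<and> y \<cdot>\<^bsub>X\<^esub> x \<in> I}"

end

(*
  For x \<sim> y the products x \<cdot> y and y \<cdot> x are both congruent to y \<cdot> y = 1; conversely, these two
  conditions give x \<sim> y exactly when the quotient is an L-algebra. Hence \<sim> is contained in
  \<psi>\<phi>(\<sim>), with equality iff X/\<sim> is an L-algebra, and given (a) the rest is formal
  up to 1 \<cdot> x = x. In (a) the delicate point is that x \<sim>\<^sub>I y implies x \<cdot> z \<sim>\<^sub>I y \<cdot> z: for a \<in> I the ideal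
  axioms say a \<cdot> u \<sim>\<^sub>I u, whence x \<cdot> z \<sim>\<^sub>I (x \<cdot> y) \<cdot> (x \<cdot> z) = (y \<cdot> x) \<cdot> (y \<cdot> z) \<sim>\<^sub>I y \<cdot> z.
*)
theory Submission
  imports Defs
begin

lemma L_congruence_refl: "L_congruence X r \<Longrightarrow> x \<in> carrier X \<Longrightarrow> (x, x) \<in> r"
  by (auto simp: L_congruence_def equiv_def refl_on_def)

lemma L_congruence_carrier: "L_congruence X r \<Longrightarrow> (x, y) \<in> r \<Longrightarrow> x \<in> carrier X \<and> y \<in> carrier X"
  by (auto simp: L_congruence_def dest: equiv_class_eq_iff[THEN iffD1])

lemma L_congruence_sym: "L_congruence X r \<Longrightarrow> (x, y) \<in> r \<Longrightarrow> (y, x) \<in> r"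
  unfolding L_congruence_def equiv_def by (blast dest: symD)

lemma L_congruence_trans: "L_congruence X r \<Longrightarrow> (x, y) \<in> r \<Longrightarrow> (y, z) \<in> r \<Longrightarrow> (x, z) \<in> r"
  unfolding L_congruence_def equiv_def by (blast dest: transD)

lemma L_congruence_lop:
  "L_congruence X r \<Longrightarrow> (x, x') \<in> r \<Longrightarrow> (y, y') \<in> r \<Longrightarrow> (x \<cdot>\<^bsub>X\<^esub> y, x' \<cdot>\<^bsub>X\<^esub> y') \<in> r"
  by (auto simp: L_congruence_def)

lemma L_ideal_carrier: "L_ideal X I \<Longrightarrow> x \<in> I \<Longrightarrow> x \<in> carrier X"
  by (auto simp: L_ideal_def)

lemma mem_unit_class_iff: "x \<in> unit_class X r \<longleftrightarrow> (\<one>\<^bsub>X\<^esub>, x) \<in> r"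
  by (simp add: unit_class_def)

lemma unit_class_mono: "r \<subseteq> s \<Longrightarrow> unit_class X r \<subseteq> unit_class X s"
  by (auto simp: unit_class_def)

lemma ideal_rel_mono: "I \<subseteq> J \<Longrightarrow> ideal_rel X I \<subseteq> ideal_rel X J"
  by (auto simp: ideal_rel_def)

lemma partial_order_inclusion: "partial_order (inclusion_order S)"
  by unfold_locales auto

context pre_L_algebra
begin

text \<open>Modulo r an element x of the unit class acts like 1: from 1 \<cdot> y = y one gets y
  congruent to x \<cdot> y. Multiplying this by y on either side gives the two conditions with y
  \<cdot> y = 1, and y \<cdot> 1 = 1 gives absorption.\<close>

lemma unit_class_ideal:
  assumes r: "L_congruence X r"
  shows "L_ideal X (unit_class X r)"
proof -
  note c = L_congruence_lop[OF r] and rf = L_congruence_refl[OF r]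
    and tr = L_congruence_trans[OF r] and sy = L_congruence_sym[OF r]
  show ?thesis
    unfolding L_ideal_def mem_unit_class_iff
  proof (intro conjI ballI impI)
    show "unit_class X r \<subseteq> carrier X"
      using L_congruence_carrier[OF r] by (auto simp: unit_class_def)
    show "(\<one>, \<one>) \<in> r" by (rule rf[OF lunit_closed])
  next
    fix x y assume x: "x \<in> carrier X" and y: "y \<in> carrier X" and x1: "(\<one>, x) \<in> r"
    have xy: "(y, x \<cdot> y) \<in> r"
      using c[OF x1 rf[OF y]] by (simp add: lunit_lop y)
    show "(\<one>, y) \<in> r" if "(\<one>, x \<cdot> y) \<in> r"
      using tr[OF that sy[OF xy]] .
    show "(\<one>, (x \<cdot> y) \<cdot> y) \<in> r"
      using c[OF xy rf[OF y]] by (simp add: lop_self y)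
    show "(\<one>, y \<cdot> x) \<in> r"
      using c[OF rf[OF y] x1] by (simp add: lop_lunit y)
    show "(\<one>, y \<cdot> (x \<cdot> y)) \<in> r"
      using c[OF rf[OF y] xy] by (simp add: lop_self y)
  qed
qed

lemma ideal_rel_congruence:
  assumes I: "L_ideal X I"
  shows "L_congruence X (ideal_rel X I)"
proof -
  let ?R = "ideal_rel X I"
  note cl = lop_closed
  have one: "\<one> \<in> I" using I by (simp add: L_ideal_def)
  have mp: "y \<in> I" if "x \<in> I" "x \<cdot> y \<in> I" "y \<in> carrier X" for x y
    using I that unfolding L_ideal_def by blast
  have absorb: "y \<cdot> x \<in> I" if "x \<in> I" "y \<in> carrier X" for x y
    using I that unfolding L_ideal_def by blast
  have ideal_act: "(a \<cdot> u, u) \<in> ?R" if a: "a \<in> I" and u: "u \<in> carrier X" for a u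
  proof -
    have "a \<in> carrier X" using L_ideal_carrier[OF I a] .
    moreover have "(a \<cdot> u) \<cdot> u \<in> I" "u \<cdot> (a \<cdot> u) \<in> I"
      using I a u unfolding L_ideal_def by blast+
    ultimately show ?thesis by (simp add: ideal_rel_def cl u)
  qed
  \<comment> \<open>By \<open>cycloid\<close>, (x \<cdot> y) \<cdot> (x \<cdot> z) equals (y \<cdot>
    x) \<cdot> (y \<cdot> z), a left multiple of y \<cdot> z \<in> I. Since x \<cdot> y \<in> I as
    well, \<open>mp\<close> detaches x \<cdot> z.\<close>
  have trans1: "x \<cdot> z \<in> I"
    if I: "x \<cdot> y \<in> I" "y \<cdot> z \<in> I" and x: "x \<in> carrier X" and y: "y \<in> carrier X" and z: "z \<in> carrier X"
    for x y z
  proof (rule mp[OF I(1)])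
    show "(x \<cdot> y) \<cdot> (x \<cdot> z) \<in> I"
      unfolding cycloid[OF x y z] by (intro absorb I(2) cl y x)
  qed (intro cl x z)
  have symR: "(x, y) \<in> ?R \<Longrightarrow> (y, x) \<in> ?R" for x y
    by (auto simp: ideal_rel_def)
  have transR: "(x, y) \<in> ?R \<Longrightarrow> (y, z) \<in> ?R \<Longrightarrow> (x, z) \<in> ?R" for x y z
    unfolding ideal_rel_def using trans1 by blast
  have equiv: "equiv (carrier X) ?R"
  proof (rule equivI)
    show "?R \<subseteq> carrier X \<times> carrier X" by (auto simp: ideal_rel_def)
    show "refl_on (carrier X) ?R"
      by (auto simp: refl_on_def ideal_rel_def lop_self one)
    show "sym ?R" using symR by (rule symI)
    show "trans ?R" using transR by (rule transI)
  qed
  \<comment> \<open>\<open>cycloid\<close> turns (z \<cdot> x) \<cdot> (z \<cdot> y) into (x \<cdot>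
    z) \<cdot> (x \<cdot> y), a left multiple of x \<cdot> y \<in> I; likewise with x and y
    exchanged.\<close>
  have left: "(z \<cdot> x, z \<cdot> y) \<in> ?R" if R: "(x, y) \<in> ?R" and z: "z \<in> carrier X" for x y z
  proof -
    have xy: "x \<in> carrier X" "y \<in> carrier X" "x \<cdot> y \<in> I" "y \<cdot> x \<in> I"
      using R by (auto simp: ideal_rel_def)
    have "(z \<cdot> x) \<cdot> (z \<cdot> y) \<in> I" "(z \<cdot> y) \<cdot> (z \<cdot> x) \<in> I"
      unfolding cycloid[OF z xy(1,2)] cycloid[OF z xy(2,1)] by (intro absorb cl xy z)+
    then show ?thesis
      using xy z cl by (simp add: ideal_rel_def)
  qed
  have right: "(x \<cdot> z, y \<cdot> z) \<in> ?R" if R: "(x, y) \<in> ?R" and z: "z \<in> carrier X" for x y z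
  proof -
    have xy: "x \<in> carrier X" "y \<in> carrier X" "x \<cdot> y \<in> I" "y \<cdot> x \<in> I"
      using R by (auto simp: ideal_rel_def)
    have "(x \<cdot> z, (x \<cdot> y) \<cdot> (x \<cdot> z)) \<in> ?R"
      using symR[OF ideal_act[OF xy(3) cl[OF xy(1) z]]] .
    moreover have "((x \<cdot> y) \<cdot> (x \<cdot> z), y \<cdot> z) \<in> ?R"
      using ideal_act[OF xy(4) cl[OF xy(2) z]] unfolding cycloid[OF xy(1,2) z] .
    ultimately show ?thesis by (rule transR)
  qed
  \<comment> \<open>One factor is changed at a time, passing through x' \<cdot> y.\<close>
  have "(x \<cdot> y, x' \<cdot> y') \<in> ?R" if "(x, x') \<in> ?R" "(y, y') \<in> ?R" for x x' y y'
    using transR[OF right[OF that(1), of y] left[OF that(2), of x']] that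
    by (auto simp: ideal_rel_def)
  with equiv show ?thesis
    unfolding L_congruence_def by blast
qed

text \<open>Since 1 \<cdot> x = x and x \<cdot> 1 = 1 \<in> I, the two conditions relating 1 and x
  reduce to x \<in> I.\<close>

lemma unit_class_ideal_rel:
  assumes I: "L_ideal X I"
  shows "unit_class X (ideal_rel X I) = I"
proof -
  have "\<one> \<in> I" using I by (simp add: L_ideal_def)
  then show ?thesis
    using L_ideal_carrier[OF I]
    by (auto simp: unit_class_def ideal_rel_def lunit_lop lop_lunit lunit_closed)
qed

text \<open>This is the unit of the adjunction; the products are compared with x \<cdot> x = 1 and y
  \<cdot> y = 1.\<close>

lemma congruence_subset_closure:
  assumes r: "L_congruence X r"
  shows "r \<subseteq> ideal_rel X (unit_class X r)"
proof clarify
  fix x y assume xy: "(x, y) \<in> r"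
  have x: "x \<in> carrier X" and y: "y \<in> carrier X"
    using L_congruence_carrier[OF r xy] by auto
  have "(\<one>, x \<cdot> y) \<in> r" "(\<one>, y \<cdot> x) \<in> r"
    using L_congruence_lop[OF r L_congruence_refl[OF r x] xy]
      L_congruence_lop[OF r L_congruence_refl[OF r y] L_congruence_sym[OF r xy]]
    by (simp_all add: lop_self x y)
  then show "(x, y) \<in> ideal_rel X (unit_class X r)"
    by (simp add: ideal_rel_def mem_unit_class_iff x y)
qed

text \<open>Forwards, r \<subseteq> \<psi>(\<phi>(r)) \<subseteq> \<psi>(I) by monotonicity of
  \<psi>; backwards, \<phi>(r) \<subseteq> \<phi>(\<psi>(I)) = I by monotonicity of \<phi>.\<close>

lemma unit_class_subset_iff:
  assumes r: "L_congruence X r" and I: "L_ideal X I"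
  shows "unit_class X r \<subseteq> I \<longleftrightarrow> r \<subseteq> ideal_rel X I"
  using congruence_subset_closure[OF r] ideal_rel_mono[of "unit_class X r" I X]
    unit_class_mono[of r "ideal_rel X I" X] unit_class_ideal_rel[OF I]
  by blast

text \<open>The quotient is always a pre-L-algebra, so only antisymmetry is at stake. Read on
  representatives, it says \<psi>(\<phi>(r)) \<subseteq> r, and the reverse inclusion always holds.
  This fixed-point criterion carries the statements about the image of \<psi> and about the least
  congruence.\<close>

lemma L_algebra_quot_iff:
  assumes r: "L_congruence X r"
  shows "L_algebra (quot X r) \<longleftrightarrow> ideal_rel X (unit_class X r) = r"
proof -
  have eq: "equiv (carrier X) r"
    using r by (simp add: L_congruence_def)
  have carrier: "carrier (quot X r) = (\<lambda>x. r `` {x}) ` carrier X"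
    by (auto simp: quot_def quotient_def)
  have unit: "\<one>\<^bsub>quot X r\<^esub> = r `` {\<one>}"
    by (simp add: quot_def)
  have prod_unit: "r `` {x} \<cdot>\<^bsub>quot X r\<^esub> r `` {y} = \<one>\<^bsub>quot X r\<^esub> \<longleftrightarrow> x \<cdot> y \<in> unit_class X r"
    if "x \<in> carrier X" "y \<in> carrier X" for x y
    using that L_congruence_sym[OF r]
    by (auto simp: quot_lop[OF r] unit eq_equiv_class_iff[OF eq] lop_closed lunit_closed
        mem_unit_class_iff)
  have "L_algebra (quot X r) \<longleftrightarrow>
      (\<forall>A\<in>carrier (quot X r). \<forall>B\<in>carrier (quot X r).
        A \<cdot>\<^bsub>quot X r\<^esub> B = \<one>\<^bsub>quot X r\<^esub> \<longrightarrow> B \<cdot>\<^bsub>quot X r\<^esub> A = \<one>\<^bsub>quot X r\<^esub> \<longrightarrow> A = B)"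
    using pre_L_algebra_quot[OF r] by (auto simp: L_algebra_def L_algebra_axioms_def)
  also have "\<dots> \<longleftrightarrow>
      (\<forall>x\<in>carrier X. \<forall>y\<in>carrier X. x \<cdot> y \<in> unit_class X r \<longrightarrow> y \<cdot> x \<in> unit_class X r \<longrightarrow> (x, y) \<in> r)"
    by (simp add: carrier prod_unit eq_equiv_class_iff[OF eq])
  also have "\<dots> \<longleftrightarrow> ideal_rel X (unit_class X r) \<subseteq> r"
    by (auto simp: ideal_rel_def)
  also have "\<dots> \<longleftrightarrow> ideal_rel X (unit_class X r) = r"
    using congruence_subset_closure[OF r] by blast
  finally show ?thesis .
qed

lemma galois_connection_unit_class_ideal_rel:
  "galois_connection \<lparr>orderA = congruences X, orderB = ideals X,
     lower = unit_class X, upper = ideal_rel X\<rparr>"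
  by (auto simp: galois_connection_def galois_connection_axioms_def connection_def
      congruences_def ideals_def partial_order_inclusion unit_class_ideal ideal_rel_congruence
      unit_class_subset_iff)

lemma isotone_unit_class: "isotone (congruences X) (ideals X) (unit_class X)"
  and isotone_ideal_rel: "isotone (ideals X) (congruences X) (ideal_rel X)"
  by (simp_all add: isotone_def congruences_def ideals_def unit_class_mono ideal_rel_mono
      partial_order_inclusion partial_order.axioms(1))

lemma closure_operator_ideal_rel_unit_class:
  "closure_operator (congruences X) (ideal_rel X \<circ> unit_class X)"
  by (simp add: closure_operator_def congruences_def partial_order_inclusion unit_class_ideal
      ideal_rel_congruence unit_class_ideal_rel
      \<comment> \<open>Read from right to left, the adjunction turns r \<subseteq>
        \<psi>(\<phi>(s)) into \<phi>(r) \<subseteq> \<phi>(s), and also \<psi>(\<phi>(r))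
        \<subseteq> \<psi>(\<phi>(s)), because \<phi>(\<psi>(\<phi>(r))) = \<phi>(r).\<close>
      flip: unit_class_subset_iff)

text \<open>Every \<psi>(I) is a fixed point of \<psi>\<phi> because \<phi>(\<psi>(I)) = I;
  conversely, a fixed point r is the image of the ideal \<phi>(r).\<close>

lemma image_ideal_rel:
  "ideal_rel X ` carrier (ideals X) = {r \<in> carrier (congruences X). L_algebra (quot X r)}"
proof (intro equalityI subsetI)
  fix r assume "r \<in> ideal_rel X ` carrier (ideals X)"
  then show "r \<in> {r \<in> carrier (congruences X). L_algebra (quot X r)}"
    by (auto simp: ideals_def congruences_def ideal_rel_congruence unit_class_ideal_rel
        L_algebra_quot_iff)
next
  fix r assume "r \<in> {r \<in> carrier (congruences X). L_algebra (quot X r)}"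
  then have "L_congruence X r" "ideal_rel X (unit_class X r) = r"
    by (auto simp: congruences_def L_algebra_quot_iff)
  then show "r \<in> ideal_rel X ` carrier (ideals X)"
    using unit_class_ideal by (force simp: ideals_def)
qed

text \<open>If s contains r and is a fixed point of \<psi>\<phi>, then \<psi>(\<phi>(r)) \<subseteq>
  \<psi>(\<phi>(s)) = s. The closure of r is itself such a fixed point, again by \<phi>\<psi> =
  id.\<close>

lemma least_L_algebra_congruence:
  assumes r: "L_congruence X r"
  shows "least (congruences X) (ideal_rel X (unit_class X r))
    {s \<in> carrier (congruences X). r \<subseteq> s \<and> L_algebra (quot X s)}"
proof -
  let ?c = "ideal_rel X (unit_class X r)"
  have "?c \<subseteq> s" if s: "L_congruence X s" "r \<subseteq> s" "L_algebra (quot X s)" for s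
    using ideal_rel_mono[OF unit_class_mono[OF s(2)], of X X] L_algebra_quot_iff[OF s(1)] s(3)
    by simp
  moreover have c: "L_congruence X ?c"
    by (intro ideal_rel_congruence unit_class_ideal r)
  moreover have "L_algebra (quot X ?c)"
    by (simp add: L_algebra_quot_iff[OF c] unit_class_ideal_rel unit_class_ideal r)
  ultimately show ?thesis
    using congruence_subset_closure[OF r]
    by (simp add: least_def congruences_def Collect_mono_iff)
qed

end

theorem proposition2p1:
  fixes X :: "('a, 'b) lstruct_scheme"
  assumes "pre_L_algebra X"
  shows
    "((\<forall>r. L_congruence X r \<longrightarrow> L_ideal X (unit_class X r)) \<and>
      (\<forall>I. L_ideal X I \<longrightarrow> L_congruence X (ideal_rel X I))) \<and>
     (\<forall>I\<in>carrier (ideals X). unit_class X (ideal_rel X I) = I) \<and>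
     (isotone (congruences X) (ideals X) (unit_class X) \<and>
      isotone (ideals X) (congruences X) (ideal_rel X) \<and>
      galois_connection \<lparr>orderA = congruences X, orderB = ideals X,
        lower = unit_class X, upper = ideal_rel X\<rparr>) \<and>
     closure_operator (congruences X) (ideal_rel X \<circ> unit_class X) \<and>
     ideal_rel X ` carrier (ideals X) = {r \<in> carrier (congruences X). L_algebra (quot X r)} \<and>
     (\<forall>r\<in>carrier (congruences X). least (congruences X) (ideal_rel X (unit_class X r))
        {s \<in> carrier (congruences X). r \<subseteq> s \<and> L_algebra (quot X s)})"
proof -
  interpret pre_L_algebra X by fact
  show ?thesis
    by (intro conjI allI ballI impI unit_class_ideal ideal_rel_congruence unit_class_ideal_rel
        isotone_unit_class isotone_ideal_rel galois_connection_unit_class_ideal_rel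
        closure_operator_ideal_rel_unit_class image_ideal_rel least_L_algebra_congruence)
      (simp_all add: ideals_def congruences_def)
qed

end
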